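(* Let $n,p,N\ge 1$ be integers, let $X\in\mathbb{R}^{n\times p}$ be such that $X^\top X$ is invertible, let $y\in\mathbb{R}^n$, and let $\Delta_1,\dots,\Delta_N\in\mathbb{R}^p$. For $i\in\{1,\dots,N\}$ let $l_i(\theta)=\|X\theta-(y+X\Delta_i)\|_2^2$ for $\theta\in\mathbb{R}^p$, and let $\theta_i^{(1)}\in\mathbb{R}^p$ be an arbitrary but fixed initial parameter for task $i$. Let $\theta'=(X^\top X)^{-1}X^\top y$ and let $l^*=\min_{\theta\in\mathbb{R}^p}\|X\theta-y\|_2^2$ (which is also the minimum value of every $l_i$). Let a target task be given by a vector $\Delta\in\mathbb{R}^p$, the loss $l_{\mathrm{target}}(\theta)=\|X\theta-(y+X\Delta)\|_2^2$, and an initial parameter $\theta^{(1)}\in\mathbb{R}^p$. For $\eta>0$, let $(B^{(k)})_{k\ge1}$ be the meta-parameters in $\mathbb{R}^{p\times p}$ produced, from an initial matrix $B^{(1)}\in\mathbb{R}^{p\times p}$, by the meta-training procedure (defined in the context) with the DCOGD inner optimizer, inner horizon $T=1$, and standard gradient descent with step size $\eta$ as the meta-optimizer. Let $l_{\mathrm{target}}^{(k)}$ be the value of $l_{\mathrm{target}}$ after one DCOGD step on the target task started at $\theta^{(1)}$ with meta-parameter $B^{(k)}$. Define $$Z_i=\theta_i^{(1)}-\Delta_i-\theta',\qquad i=1,\dots,N.$$ If $\{Z_i\}_{i=1}^N$ spans $\mathbb{R}^p$, then there exists a (sufficiently small) step size $\eta>0$ such that the one-step target task loss approaches the optimum $l^*$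 as the number of meta-steps $k\to\infty$; specifically, for some $0<\epsilon<1$, $$l_{\mathrm{target}}^{(k)}-l^*\le O\big((1-\epsilon)^k\big),$$ i.e. there is a constant $C$ independent of $k$ with $l_{\mathrm{target}}^{(k)}-l^*\le C(1-\epsilon)^k$ for all $k\ge1$.
   Context: DCOGD step: given a meta-parameter $B\in\mathbb{R}^{p\times p}$, a differentiable loss $l:\mathbb{R}^p\to\mathbb{R}$ and a current point $\vartheta\in\mathbb{R}^p$, the DCOGD (differentiable convex optimization, general descent) update is $$\mathrm{Opt}(\vartheta;l,B)=\operatorname*{arg\,min}_{\theta\in\mathbb{R}^p}\Big\{\big(B\,\nabla l(\vartheta)\big)^\top\theta+\tfrac12\|\theta-\vartheta\|_2^2\Big\}.$$ Meta-training procedure with $T=1$: the training loss and the validation loss of each task coincide (both equal $l_i$). The total meta-loss is $$l^{\mathrm{total}}(B)=\frac1N\sum_{i=1}^N l_i\big(\mathrm{Opt}(\theta_i^{(1)};l_i,B)\big),\qquad B\in\mathbb{R}^{p\times p},$$ where the initial parameters $\theta_i^{(1)}$ are the same at every meta-step. With gradient descent of step size $\eta$ as meta-optimizer, starting from the initial meta-parameter $B^{(1)}$, the meta-parameters are updated by $$B^{(k+1)}=B^{(k)}-\eta\,\nabla_B l^{\mathrm{total}}(B^{(k)}),\qquad k\ge1,$$ where $\nabla_B$ is the gradient with respect to the entries of $B$. One-step target loss: $l_{\mathrm{target}}^{(k)}=l_{\mathrm{target}}\big(\mathrm{Opt}(\theta^{(1)};l_{\mathrm{target}},B^{(k)})\big)$.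 *)

theory Defs
  imports "HOL-Analysis.Analysis"
begin

definition grad :: "('a::real_inner \<Rightarrow> real) \<Rightarrow> 'a \<Rightarrow> 'a" where
  "grad f x = (THE D. GDERIV f x :> D)"

definition dcogd ::
  "real^'p \<Rightarrow> (real^'p \<Rightarrow> real) \<Rightarrow> real^'p^'p \<Rightarrow> real^'p" where
  "dcogd v l B =
     arg_min (\<lambda>\<theta>. (B *v grad l v) \<bullet> \<theta> + 1/2 * (norm (\<theta> - v))\<^sup>2) (\<lambda>_. True)"

definition total_meta_loss ::
  "nat \<Rightarrow> (nat \<Rightarrow> real^'p \<Rightarrow> real) \<Rightarrow> (nat \<Rightarrow> real^'p) \<Rightarrow> real^'p^'p \<Rightarrow> real" where
  "total_meta_loss N l \<theta>1 B = 1 / real N * (\<Sum>i = 1..N. l i (dcogd (\<theta>1 i) (l i) B))"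

text \<open>
  Meta-steps are counted from \<open>k = 1\<close>, with \<open>B1\<close> the value at \<open>k = 1\<close>.
  The inner product of \<^typ>\<open>real^'p^'p\<close> is the Frobenius one, so \<open>grad\<close> collects the
  partial derivatives with respect to the matrix entries.
\<close>

definition meta_param ::
  "(real^'p^'p \<Rightarrow> real) \<Rightarrow> real \<Rightarrow> real^'p^'p \<Rightarrow> nat \<Rightarrow> real^'p^'p" where
  "meta_param L \<eta> B1 k = ((\<lambda>B. B - \<eta> *\<^sub>R grad L B) ^^ (k - 1)) B1"

definition task_loss ::
  "real^'p^'n \<Rightarrow> real^'n \<Rightarrow> real^'p \<Rightarrow> real^'p \<Rightarrow> real" where
  "task_loss X y \<Delta> \<theta> = (norm (X *v \<theta> - (y + X *v \<Delta>)))\<^sup>2"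

definition ls_solution :: "real^'p^'n \<Rightarrow> real^'n \<Rightarrow> real^'p" where
  "ls_solution X y = matrix_inv (transpose X ** X) *v (transpose X *v y)"

definition ls_min :: "real^'p^'n \<Rightarrow> real^'n \<Rightarrow> real" where
  "ls_min X y = (LEAST m. m \<in> range (\<lambda>\<theta>. (norm (X *v \<theta> - y))\<^sup>2))"

definition target_loss ::
  "real^'p^'n \<Rightarrow> real^'n \<Rightarrow> nat \<Rightarrow> (nat \<Rightarrow> real^'p) \<Rightarrow> (nat \<Rightarrow> real^'p) \<Rightarrow>
   real^'p \<Rightarrow> real^'p \<Rightarrow> real \<Rightarrow> real^'p^'p \<Rightarrow> nat \<Rightarrow> real" where
  "target_loss X y N \<Delta> \<theta>1 \<Delta>t \<theta>t \<eta> B1 k =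
     task_loss X y \<Delta>t
       (dcogd \<theta>t (task_loss X y \<Delta>t)
         (meta_param (total_meta_loss N (\<lambda>i. task_loss X y (\<Delta> i)) \<theta>1) \<eta> B1 k))"

end

theory Submission
  imports Defs
begin

text \<open>
  Let \<open>r = y - X \<theta>'\<close> be the least-squares residual, so that every loss is
  \<open>\<parallel>X (\<theta> - \<Delta> - \<theta>')\<parallel>\<^sup>2 + \<parallel>r\<parallel>\<^sup>2\<close>.
  Put \<open>A = X\<^sup>T X\<close> and \<open>E = B - A\<^sup>-\<^sup>1 / 2\<close>. With \<open>z = v - \<Delta> - \<theta>'\<close> and \<open>w = 2 A z\<close>, one DCOGD step
  from \<open>v\<close> turns \<open>z\<close> into \<open>z - B w = - E w\<close>, so the loss after the step is \<open>\<parallel>X E w\<parallel>\<^sup>2 + \<parallel>r\<parallel>\<^sup>2\<close>.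
  Hence the meta-loss is a quadratic form in \<open>E\<close> plus a constant. The form is positive
  definite because \<open>X\<close> is injective and the \<open>w\<^sub>i = 2 A Z\<^sub>i\<close> span the space, so gradient descent
  drives \<open>E\<close> to zero at a linear rate, whatever the target task is.
\<close>

section \<open>Gradients and the closed form of a DCOGD step\<close>

lemma grad_eqI:
  assumes "GDERIV f x :> D"
  shows "grad f x = D"
  unfolding grad_def
proof (rule the_equality)
  show "GDERIV f x :> D"
    by (fact assms)
  fix D'
  assume "GDERIV f x :> D'"
  then have "(\<lambda>h. h \<bullet> D') = (\<lambda>h. h \<bullet> D)"
    using assms unfolding gderiv_def by (rule has_derivative_unique)
  then show "D' = D"
    by (metis vector_eq_ldot)
qed

text \<open>Kept abstract because it serves twice: for \<open>F\<close> multiplying a parameter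
  vector by \<open>X\<close>, and for \<open>F\<close> sending a matrix \<open>E\<close> to
  \<open>X E w\<close>. In the second use the adjoint never has to be computed.\<close>

lemma GDERIV_norm_square_linear:
  fixes F :: "'a::euclidean_space \<Rightarrow> 'b::euclidean_space"
  assumes "linear F"
  shows "GDERIV (\<lambda>x. (norm (F (x - a)))\<^sup>2) x :> 2 *\<^sub>R adjoint F (F (x - a))"
proof -
  interpret bounded_linear F
    using assms by (simp add: linear_conv_bounded_linear)
  have "((\<lambda>x. F (x - a)) has_derivative F) (at x)"
    using has_derivative[OF has_derivative_diff[OF has_derivative_ident has_derivative_const]] by simp
  then have "((\<lambda>x. F (x - a) \<bullet> F (x - a)) has_derivative
      (\<lambda>h. F (x - a) \<bullet> F h + F h \<bullet> F (x - a))) (at x)"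
    by (intro has_derivative_inner)
  moreover have "(\<lambda>h. F (x - a) \<bullet> F h + F h \<bullet> F (x - a)) =
      (\<lambda>h. h \<bullet> (2 *\<^sub>R adjoint F (F (x - a))))"
    by (simp add: adjoint_works[OF assms] inner_commute)
  ultimately show ?thesis
    by (simp only: gderiv_def power2_norm_eq_inner)
qed

text \<open>Completing the square: the objective exceeds its value at
  \<open>v - B *v grad l v\<close> by half the squared distance to that point. The minimizer is
  therefore unique, which determines the choice made by \<open>arg_min\<close>.\<close>

lemma dcogd_eq: "dcogd v l B = v - B *v grad l v"
proof -
  let ?g = "B *v grad l v"
  let ?f = "\<lambda>\<theta>. ?g \<bullet> \<theta> + 1/2 * (norm (\<theta> - v))\<^sup>2"
  have f: "?f \<theta> = ?f (v - ?g) + 1/2 * (norm (\<theta> - (v - ?g)))\<^sup>2" for \<theta>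
    by (simp add: power2_norm_eq_inner algebra_simps inner_commute)
  have "is_arg_min ?f (\<lambda>_. True) \<theta> \<longleftrightarrow> \<theta> = v - ?g" for \<theta>
  proof
    assume "is_arg_min ?f (\<lambda>_. True) \<theta>"
    then have "?f \<theta> \<le> ?f (v - ?g)"
      unfolding is_arg_min_linorder by blast
    then have "(norm (\<theta> - (v - ?g)))\<^sup>2 \<le> 0"
      using f[of \<theta>] by linarith
    then show "\<theta> = v - ?g"
      by simp
  next
    assume \<theta>: "\<theta> = v - ?g"
    have "?f (v - ?g) \<le> ?f x" for x
      using f[of x] zero_le_power2[of "norm (x - (v - ?g))"] by linarith
    then show "is_arg_min ?f (\<lambda>_. True) \<theta>"
      unfolding \<theta> is_arg_min_linorder by blast
  qed
  then have "is_arg_min ?f (\<lambda>_. True) = (\<lambda>\<theta>. \<theta> = v - ?g)"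
    by blast
  then show ?thesis
    unfolding dcogd_def arg_min_def by simp
qed

section \<open>Contraction of gradient descent when the gradient is a positive definite linear
  map\<close>

lemma gradient_step_contraction:
  fixes G :: "'a::euclidean_space \<Rightarrow> 'a"
  assumes "linear G" and pos: "\<And>x. x \<noteq> 0 \<Longrightarrow> x \<bullet> G x > 0"
  shows "\<exists>\<eta>>0. \<exists>\<epsilon>. 0 < \<epsilon> \<and> \<epsilon> < 1 \<and> (\<forall>x. (norm (x - \<eta> *\<^sub>R G x))\<^sup>2 \<le> (1 - \<epsilon>) * (norm x)\<^sup>2)"
proof -
  interpret bounded_linear G
    using assms(1) by (simp add: linear_conv_bounded_linear)
  \<comment> \<open>By compactness the form attains its minimum \<open>m\<close> on the unit sphere,
    so \<open>m\<close> is positive; homogeneity extends the bound to all vectors.\<close>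
  have "continuous_on (sphere 0 1) (\<lambda>x. x \<bullet> G x)"
    by (intro continuous_intros continuous_on)
  moreover have "sphere (0::'a) 1 \<noteq> {}"
    by simp
  ultimately obtain u where u: "norm u = 1" "\<And>x. norm x = 1 \<Longrightarrow> u \<bullet> G u \<le> x \<bullet> G x"
    using continuous_attains_inf[OF compact_sphere, of 0 1 "\<lambda>x. x \<bullet> G x"] by auto
  define m where "m = u \<bullet> G u"
  have "m > 0"
    unfolding m_def using u(1) by (intro pos) auto
  have lower: "m * (norm x)\<^sup>2 \<le> x \<bullet> G x" for x
  proof (cases "x = 0")
    case False
    then have "m \<le> (x /\<^sub>R norm x) \<bullet> G (x /\<^sub>R norm x)"
      unfolding m_def by (intro u(2)) simp
    with False show ?thesis
      by (simp add: scaleR field_simps power2_eq_square)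
  qed simp
  obtain K' where K': "K' > 0" "\<And>x. norm (G x) \<le> norm x * K'"
    using pos_bounded by blast
  \<comment> \<open>Adding \<open>m\<close> to the operator bound forces \<open>m < K\<close>, so
    that the rate \<open>1 - m\<^sup>2 / K\<^sup>2\<close> lies strictly between 0 and 1.\<close>
  define K where "K = K' + m"
  have K: "K > m" "norm (G x) \<le> K * norm x" for x
    using K' \<open>m > 0\<close> by (auto simp: K_def algebra_simps intro: add_increasing2)
  show ?thesis
  proof (intro exI conjI allI)
    \<comment> \<open>The witnesses are fixed here: the step size \<open>m / K\<^sup>2\<close>
      minimizes \<open>1 - 2 * \<eta> * m + \<eta>\<^sup>2 * K\<^sup>2\<close>, the contraction
      factor obtained by expanding the square, and the minimum is
      \<open>1 - m\<^sup>2 / K\<^sup>2\<close>.\<close>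
    show "0 < m / K\<^sup>2" "0 < m\<^sup>2 / K\<^sup>2"
      using \<open>m > 0\<close> K(1) by auto
    show "m\<^sup>2 / K\<^sup>2 < 1"
      using \<open>m > 0\<close> K(1) by (simp add: power_strict_mono)
  next
    fix x
    \<comment> \<open>For this step size the quadratic term costs at most
      \<open>m\<^sup>2 / K\<^sup>2 * (norm x)\<^sup>2\<close>, while the cross term gains at least
      twice that.\<close>
    have "(norm (G x))\<^sup>2 \<le> K\<^sup>2 * (norm x)\<^sup>2"
      using power_mono[OF K(2), of x 2] by (simp add: power_mult_distrib)
    then have "(m / K\<^sup>2)\<^sup>2 * (norm (G x))\<^sup>2 \<le> (m / K\<^sup>2)\<^sup>2 * (K\<^sup>2 * (norm x)\<^sup>2)"
      by (intro mult_left_mono) auto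
    also have "\<dots> = m\<^sup>2 / K\<^sup>2 * (norm x)\<^sup>2"
      using \<open>m > 0\<close> K(1) by (simp add: field_simps power2_eq_square)
    finally have sq: "(m / K\<^sup>2)\<^sup>2 * (norm (G x))\<^sup>2 \<le> m\<^sup>2 / K\<^sup>2 * (norm x)\<^sup>2" .
    have "m / K\<^sup>2 * (m * (norm x)\<^sup>2) \<le> m / K\<^sup>2 * (x \<bullet> G x)"
      using \<open>m > 0\<close> by (intro mult_left_mono lower) auto
    then have cross: "m\<^sup>2 / K\<^sup>2 * (norm x)\<^sup>2 \<le> m / K\<^sup>2 * (x \<bullet> G x)"
      by (simp add: power2_eq_square)
    have "(norm (x - (m / K\<^sup>2) *\<^sub>R G x))\<^sup>2 =
        (norm x)\<^sup>2 - 2 * (m / K\<^sup>2 * (x \<bullet> G x)) + (m / K\<^sup>2)\<^sup>2 * (norm (G x))\<^sup>2"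
      unfolding power2_norm_eq_inner
      by (simp add: inner_diff_left inner_diff_right inner_commute power2_eq_square)
    also have "\<dots> \<le> (1 - m\<^sup>2 / K\<^sup>2) * (norm x)\<^sup>2"
      using sq cross by (simp add: left_diff_distrib)
    finally show "(norm (x - (m / K\<^sup>2) *\<^sub>R G x))\<^sup>2 \<le> (1 - m\<^sup>2 / K\<^sup>2) * (norm x)\<^sup>2" .
  qed
qed

lemma norm_square_iterate_le:
  fixes a :: "'a::real_normed_vector"
  assumes step: "\<And>x. (norm (f x - a))\<^sup>2 \<le> c * (norm (x - a))\<^sup>2" and "0 \<le> c"
  shows "(norm ((f ^^ j) x - a))\<^sup>2 \<le> c ^ j * (norm (x - a))\<^sup>2"
proof (induction j)
  case (Suc j)
  have "(norm ((f ^^ Suc j) x - a))\<^sup>2 \<le> c * (norm ((f ^^ j) x - a))\<^sup>2"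
    by (simp add: step)
  also have "\<dots> \<le> c * (c ^ j * (norm (x - a))\<^sup>2)"
    using Suc \<open>0 \<le> c\<close> by (rule mult_left_mono)
  finally show ?case
    by (simp add: mult.assoc)
qed simp

section \<open>Matrix facts, least squares and the loss after one DCOGD step\<close>

lemma linear_matrix_vector_left: "linear (\<lambda>E :: real^'n^'m. E *v w)"
  by (rule linearI) (simp_all add: matrix_vector_mult_add_rdistrib scaleR_matrix_vector_assoc)

lemma matrix_inv_right:
  assumes "invertible A"
  shows "A ** matrix_inv A = mat 1"
  using assms unfolding invertible_def matrix_inv_def by (rule someI2_ex) blast

lemma matrix_inv_left:
  assumes "invertible A"
  shows "matrix_inv A ** A = mat 1"
  using assms unfolding invertible_def matrix_inv_def by (rule someI2_ex) blast

text \<open>The normal equations make the residual of \<open>ls_solution X y\<close> orthogonal to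
  the range of \<open>X\<close>; the rest is Pythagoras.\<close>

lemma norm_square_residual:
  fixes X :: "real^'p^'n"
  assumes "invertible (transpose X ** X)"
  shows "(norm (X *v \<theta> - y))\<^sup>2 =
    (norm (X *v (\<theta> - ls_solution X y)))\<^sup>2 + (norm (X *v ls_solution X y - y))\<^sup>2"
proof -
  let ?s = "ls_solution X y"
  have "transpose X *v (X *v ?s) = ((transpose X ** X) ** matrix_inv (transpose X ** X)) *v (transpose X *v y)"
    by (simp add: ls_solution_def matrix_vector_mul_assoc matrix_mul_assoc)
  then have normal: "transpose X *v (X *v ?s - y) = 0"
    by (simp add: matrix_inv_right[OF assms] matrix_vector_mult_diff_distrib)
  have "(X *v (\<theta> - ?s)) \<bullet> (X *v ?s - y) = 0"
    using normal dot_lmul_matrix[of "X *v ?s - y" X "\<theta> - ?s"]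
    by (simp add: inner_commute)
  moreover have "X *v \<theta> - y = X *v (\<theta> - ?s) + (X *v ?s - y)"
    by (simp add: matrix_vector_mult_diff_distrib)
  ultimately show ?thesis
    by (simp only: norm_add_Pythagorean orthogonal_def)
qed

lemma ls_min_eq:
  fixes X :: "real^'p^'n"
  assumes "invertible (transpose X ** X)"
  shows "ls_min X y = (norm (X *v ls_solution X y - y))\<^sup>2"
  unfolding ls_min_def
proof (rule Least_equality)
  fix m
  assume "m \<in> range (\<lambda>\<theta>. (norm (X *v \<theta> - y))\<^sup>2)"
  then obtain \<theta> where "m = (norm (X *v \<theta> - y))\<^sup>2"
    by blast
  then show "(norm (X *v ls_solution X y - y))\<^sup>2 \<le> m"
    using norm_square_residual[OF assms, of \<theta> y] by simp
qed blast

lemma task_loss_eq: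
  fixes X :: "real^'p^'n"
  assumes "invertible (transpose X ** X)"
  shows "task_loss X y \<Delta> \<theta> = (norm (X *v (\<theta> - \<Delta> - ls_solution X y)))\<^sup>2 + ls_min X y"
proof -
  have "X *v \<theta> - (y + X *v \<Delta>) = X *v (\<theta> - \<Delta>) - y"
    by (simp add: matrix_vector_mult_diff_distrib)
  then show ?thesis
    unfolding task_loss_def ls_min_eq[OF assms] by (simp only: norm_square_residual[OF assms, of "\<theta> - \<Delta>" y])
qed

lemma grad_task_loss:
  fixes X :: "real^'p^'n"
  assumes "invertible (transpose X ** X)"
  shows "grad (task_loss X y \<Delta>) v = 2 *\<^sub>R ((transpose X ** X) *v (v - \<Delta> - ls_solution X y))"
proof (rule grad_eqI)
  have "GDERIV (\<lambda>\<theta>. (norm (X *v (\<theta> - (\<Delta> + ls_solution X y))))\<^sup>2 + ls_min X y) v :>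
      2 *\<^sub>R adjoint ((*v) X) (X *v (v - (\<Delta> + ls_solution X y))) + 0"
    by (intro GDERIV_add GDERIV_const GDERIV_norm_square_linear matrix_vector_mul_linear)
  moreover have "task_loss X y \<Delta> = (\<lambda>\<theta>. (norm (X *v (\<theta> - (\<Delta> + ls_solution X y))))\<^sup>2 + ls_min X y)"
    by (simp add: fun_eq_iff task_loss_eq[OF assms] diff_diff_eq)
  ultimately show "GDERIV (task_loss X y \<Delta>) v :> 2 *\<^sub>R ((transpose X ** X) *v (v - \<Delta> - ls_solution X y))"
    by (simp add: adjoint_matrix diff_diff_eq flip: matrix_vector_mul_assoc)
qed

text \<open>The Hessian of each task loss is \<open>2 *\<^sub>R A\<close>, so
  \<open>(1/2) *\<^sub>R matrix_inv A\<close> turns the DCOGD step into a Newton step, which solves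
  every such task at once. What remains of the loss above its minimum comes from the deviation of
  \<open>B\<close> from that matrix.\<close>

lemma task_loss_dcogd:
  fixes X :: "real^'p^'n"
  assumes inv: "invertible (transpose X ** X)"
  defines "A \<equiv> transpose X ** X"
  shows "task_loss X y \<Delta> (dcogd v (task_loss X y \<Delta>) B) =
    (norm (X *v ((B - (1/2) *\<^sub>R matrix_inv A) *v (2 *\<^sub>R (A *v (v - \<Delta> - ls_solution X y))))))\<^sup>2
      + ls_min X y"
proof -
  let ?z = "v - \<Delta> - ls_solution X y"
  let ?w = "2 *\<^sub>R (A *v ?z)"
  have "((1/2) *\<^sub>R matrix_inv A) *v ?w = (1/2) *\<^sub>R (matrix_inv A *v ?w)"
    by (simp only: scaleR_matrix_vector_assoc)
  also have "\<dots> = (matrix_inv A ** A) *v ?z"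
    by (simp add: matrix_vector_mult_scaleR matrix_vector_mul_assoc)
  finally have "((1/2) *\<^sub>R matrix_inv A) *v ?w = (matrix_inv A ** A) *v ?z" .
  then have z: "((1/2) *\<^sub>R matrix_inv A) *v ?w = ?z"
    using matrix_inv_left[OF inv] by (simp add: A_def)
  have "dcogd v (task_loss X y \<Delta>) B - \<Delta> - ls_solution X y = ?z - B *v ?w"
    by (simp add: dcogd_eq grad_task_loss[OF inv] A_def)
  also have "\<dots> = - ((B - (1/2) *\<^sub>R matrix_inv A) *v ?w)"
    using z by (simp add: matrix_vector_mult_diff_rdistrib)
  finally show ?thesis
    by (simp only: task_loss_eq[OF inv, of y \<Delta> "dcogd v (task_loss X y \<Delta>) B"]
        linear_neg[OF matrix_vector_mul_linear] norm_minus_cancel)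
qed

section \<open>Linear convergence of the meta-parameters and of the target loss\<close>

theorem theorem1:
  fixes X :: "real^'p^'n" and y :: "real^'n"
    and N :: nat and \<Delta> \<theta>1 :: "nat \<Rightarrow> real^'p"
    and \<Delta>t \<theta>t :: "real^'p" and B1 :: "real^'p^'p"
  assumes "N \<ge> 1"
    and "invertible (transpose X ** X)"
    and "span ((\<lambda>i. \<theta>1 i - \<Delta> i - ls_solution X y) ` {1..N}) = UNIV"
  shows "\<exists>\<eta>>0.
           (target_loss X y N \<Delta> \<theta>1 \<Delta>t \<theta>t \<eta> B1 \<longlonglongrightarrow> ls_min X y) \<and>
           (\<exists>\<epsilon>. 0 < \<epsilon> \<and> \<epsilon> < 1 \<and>
             (\<exists>C. \<forall>k\<ge>1. target_loss X y N \<Delta> \<theta>1 \<Delta>t \<theta>t \<eta> B1 k - ls_min X y \<le> C * (1 - \<epsilon>) ^ k))"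
proof -
  note inv = assms(2)
  define A where "A = transpose X ** X"
  define S where "S = (1/2) *\<^sub>R matrix_inv A"
  define Z where "Z i = \<theta>1 i - \<Delta> i - ls_solution X y" for i
  define F where "F i E = X *v (E *v (2 *\<^sub>R (A *v Z i)))" for i and E :: "real^'p^'p"
  define Ft where "Ft E = X *v (E *v (2 *\<^sub>R (A *v (\<theta>t - \<Delta>t - ls_solution X y))))" for E :: "real^'p^'p"
  \<comment> \<open>This is the gradient of the meta-loss expressed in the error
    \<open>E = B - S\<close>. As it is linear in \<open>E\<close>, a meta-step on \<open>B\<close>
    acts on the error as \<open>E - \<eta> *\<^sub>R G E\<close>.\<close>
  define G where "G E = (\<Sum>i = 1..N. (2 / real N) *\<^sub>R adjoint (F i) (F i E))" for E
  define L where "L = total_meta_loss N (\<lambda>i. task_loss X y (\<Delta> i)) \<theta>1"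
  have linF: "linear (F i)" for i
    unfolding F_def by (intro linear_compose[OF linear_matrix_vector_left, unfolded o_def] matrix_vector_mul_linear)
  have linFt: "linear Ft"
    unfolding Ft_def by (intro linear_compose[OF linear_matrix_vector_left, unfolded o_def] matrix_vector_mul_linear)
  have linG: "linear G"
    unfolding G_def
    by (intro linear_compose_sum ballI linear_compose_scale_right
        linear_compose[OF linF adjoint_linear[OF linF], unfolded o_def])

  have L_eq: "L = (\<lambda>B. \<Sum>i = 1..N. 1 / real N * ((norm (F i (B - S)))\<^sup>2 + ls_min X y))"
    by (simp add: fun_eq_iff L_def total_meta_loss_def task_loss_dcogd[OF inv] F_def S_def A_def Z_def sum_distrib_left)
  have "GDERIV (\<lambda>B. 1 / real N * ((norm (F i (B - S)))\<^sup>2 + ls_min X y)) B :>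
      (2 / real N) *\<^sub>R adjoint (F i) (F i (B - S))" for i B
    using GDERIV_mult[OF GDERIV_const[of "1 / real N"]
        GDERIV_add[OF GDERIV_norm_square_linear[OF linF[of i], of S B] GDERIV_const[of "ls_min X y"]]]
    by (simp add: mult.commute)
  then have "GDERIV L B :> G (B - S)" for B
    unfolding L_eq G_def gderiv_def inner_sum_right by (intro has_derivative_sum)
  then have grad_L: "grad L B = G (B - S)" for B
    by (rule grad_eqI)

  have pos: "E \<bullet> G E > 0" if "E \<noteq> 0" for E
  proof -
    \<comment> \<open>Moving the adjoints across leaves a weighted sum of squares, so a single task
      with \<open>F i E \<noteq> 0\<close> is enough.\<close>
    have EG: "E \<bullet> G E = (\<Sum>i = 1..N. 2 / real N * (norm (F i E))\<^sup>2)"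
      by (simp add: G_def inner_sum_right adjoint_works[OF linF] power2_norm_eq_inner)
    have "\<exists>i\<in>{1..N}. F i E \<noteq> 0"
    proof (rule ccontr)
      assume "\<not> ?thesis"
      then have zero: "X *v (E *v (A *v Z i)) = 0" if "i \<in> {1..N}" for i
        using that by (simp add: F_def matrix_vector_mult_scaleR)
      \<comment> \<open>Multiplying \<open>zero\<close> by \<open>transpose X\<close> turns the
        leading \<open>X\<close> into \<open>A\<close>. Thus \<open>A ** E ** A\<close> kills every
        \<open>Z i\<close>, hence the whole space by the spanning hypothesis, and cancelling the
        invertible \<open>A\<close> on both sides gives \<open>E = 0\<close>.\<close>
      have "(A ** E ** A) *v z = 0" for z
      proof (rule linear_eq_0_on_span[where f = "(*v) (A ** E ** A)" and b = "Z ` {1..N}"])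
        show "linear ((*v) (A ** E ** A))"
          by (rule matrix_vector_mul_linear)
        show "z \<in> span (Z ` {1..N})"
          using assms(3) by (simp add: Z_def)
        show "(A ** E ** A) *v b = 0" if "b \<in> Z ` {1..N}" for b
          using that zero by (auto simp: A_def simp flip: matrix_vector_mul_assoc)
      qed
      then have "A ** E ** A = 0"
        by (simp add: matrix_eq)
      moreover have "E = (matrix_inv A ** A) ** E ** (A ** matrix_inv A)"
        using matrix_inv_left[OF inv] matrix_inv_right[OF inv] by (simp add: A_def)
      then have "E = matrix_inv A ** (A ** E ** A) ** matrix_inv A"
        by (simp add: matrix_mul_assoc)
      ultimately show False
        using that by simp
    qed
    then show ?thesis
      unfolding EG using \<open>N \<ge> 1\<close> by (force intro: sum_pos2)
  qed

  obtain \<eta> \<epsilon> where "\<eta> > 0" and \<epsilon>: "0 < \<epsilon>" "\<epsilon> < 1"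
    and contr: "\<And>E. (norm (E - \<eta> *\<^sub>R G E))\<^sup>2 \<le> (1 - \<epsilon>) * (norm E)\<^sup>2"
    using gradient_step_contraction[OF linG pos] by blast
  \<comment> \<open>The target task enters the bound only through this constant: \<eta> and
    \<epsilon> come from \<open>G\<close>, which is built from the training tasks alone.\<close>
  obtain K where K: "\<And>E. norm (Ft E) \<le> K * norm E"
    using linear_bounded[OF linFt] by blast
  \<comment> \<open>Index \<open>k\<close> has seen only \<open>k - 1\<close> meta-steps, since
    \<open>B1\<close> sits at \<open>k = 1\<close>; dividing by \<open>1 - \<epsilon>\<close> makes
    up for the missing factor.\<close>
  define C where "C = K\<^sup>2 * (norm (B1 - S))\<^sup>2 / (1 - \<epsilon>)"
  let ?t = "target_loss X y N \<Delta> \<theta>1 \<Delta>t \<theta>t \<eta> B1"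
  have t_eq: "?t k = (norm (Ft (meta_param L \<eta> B1 k - S)))\<^sup>2 + ls_min X y" for k
    by (simp add: target_loss_def task_loss_dcogd[OF inv] Ft_def S_def A_def L_def)
  have bound: "?t k - ls_min X y \<le> C * (1 - \<epsilon>) ^ k" if "k \<ge> 1" for k
  proof -
    \<comment> \<open>The contraction of the error, translated back to meta-parameters:
      \<open>S\<close> is the fixed point of the meta-step.\<close>
    have "(norm (B - \<eta> *\<^sub>R grad L B - S))\<^sup>2 \<le> (1 - \<epsilon>) * (norm (B - S))\<^sup>2" for B
      using contr[of "B - S"] by (simp add: grad_L algebra_simps)
    then have "(norm (meta_param L \<eta> B1 k - S))\<^sup>2 \<le> (1 - \<epsilon>) ^ (k - 1) * (norm (B1 - S))\<^sup>2"
      unfolding meta_param_def using \<epsilon> by (intro norm_square_iterate_le) auto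
    then have "K\<^sup>2 * (norm (meta_param L \<eta> B1 k - S))\<^sup>2 \<le> K\<^sup>2 * ((1 - \<epsilon>) ^ (k - 1) * (norm (B1 - S))\<^sup>2)"
      by (intro mult_left_mono) auto
    also have "\<dots> = C * (1 - \<epsilon>) ^ k"
      using that \<epsilon> by (cases k) (auto simp: C_def)
    finally show ?thesis
      using power_mono[OF K norm_ge_zero, of "meta_param L \<eta> B1 k - S" 2]
      by (simp add: t_eq power_mult_distrib)
  qed
  have "(\<lambda>k. ls_min X y + C * (1 - \<epsilon>) ^ k) \<longlonglongrightarrow> ls_min X y + C * 0"
    using \<epsilon> by (intro tendsto_intros LIMSEQ_realpow_zero) auto
  then have upper: "(\<lambda>k. ls_min X y + C * (1 - \<epsilon>) ^ k) \<longlonglongrightarrow> ls_min X y"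
    by simp
  have "?t \<longlonglongrightarrow> ls_min X y"
  proof (rule tendsto_sandwich[OF _ _ tendsto_const upper])
    show "\<forall>\<^sub>F k in sequentially. ls_min X y \<le> ?t k"
      by (simp add: t_eq)
    \<comment> \<open>The estimate is available from \<open>k = 1\<close> on. At
      \<open>k = 0\<close> truncated subtraction yields \<open>B1\<close> again, and the limit
      ignores this index.\<close>
    show "\<forall>\<^sub>F k in sequentially. ?t k \<le> ls_min X y + C * (1 - \<epsilon>) ^ k"
      using eventually_ge_at_top[of 1] by eventually_elim (use bound in fastforce)
  qed
  with \<open>\<eta> > 0\<close> \<epsilon> bound show ?thesis
    by blast
qed

end
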